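(* Both the spin and rotation of real wave numbers are additively and multiplicatively conserved quantities. That is, for real wave numbers ${\bf A}_1{\bf w}(f_1,\theta_1)$ and ${\bf A}_2{\bf w}(f_2,\theta_2)$, $${\bf A}_1{\bf w}(f_1,\theta_1)\otimes{\bf A}_2{\bf w}(f_2,\theta_2)={\bf A}_1{\bf A}_2\,{\bf w}(f_1+f_2,\theta_1+\theta_2)$$ and $${\bf A}_1{\bf w}(f_1,\theta_1)\oplus{\bf A}_2{\bf w}(f_2,\theta_2)=\hat{\bf A}_{12}\,{\bf w}(f_1+f_2,\theta_1+\theta_2)$$ for a generalized amplitude $\hat{\bf A}_{12}$.
   Context: For $f,\theta\in\mathbb{R}$, ${\bf w}(f,\theta)$ is the function $\rho\mapsto e^{i2\pi(f\rho+\theta)}$ of $\rho\in\mathbb{R}$. The operators $\otimes$, $\oplus$ and $I$ are multiplication, addition and inverse, with the usual arithmetic operations applied pointwise in $\rho$; juxtaposition denotes the pointwise product. The real wave numbers $\mathbb{W}$ are the elements generated from the functions ${\bf w}(f,\theta)$, $f,\theta\in\mathbb{R}$, under the closure of the operators $\otimes$, $\oplus$ and $I$. A real wave number has the form ${\bf A}\,{\bf w}(f,\theta)$, with generalized amplitude ${\bf A}\in\mathbb{W}$ and generalized exponential term ${\bf w}(f,\theta)$. The spin and rotation of a real wave number ${\bf A}\,{\bf w}(f,\theta)$ are $f$ and $\theta$, respectively. *)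

theory Defs
  imports Complex_Main
begin

text \<open>
  Inverting a wave number such as 1 + w(1,0), which has zeros, yields a function that is
  undefined at those zeros.  Wave numbers are therefore modelled as partial functions of the
  real variable \<open>\<rho>\<close>: the operations are pointwise and strict in undefinedness, and equality
  means equal domains and equal values.  The elements that are defined on all of the reals are
  exactly those generated when inversion is restricted to nowhere vanishing functions.
\<close>

type_synonym wave_fun = "real \<rightharpoonup> complex"

definition wave :: "real \<Rightarrow> real \<Rightarrow> wave_fun" where
  "wave f \<theta> = (\<lambda>\<rho>. Some (exp (\<i> * 2 * of_real pi * of_real (f * \<rho> + \<theta>))))"

definition wave_mult :: "wave_fun \<Rightarrow> wave_fun \<Rightarrow> wave_fun"  (infixl "\<otimes>" 70) where
  "A \<otimes> B = (\<lambda>\<rho>. case (A \<rho>, B \<rho>) of (Some a, Some b) \<Rightarrow> Some (a * b) | _ \<Rightarrow> None)"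

definition wave_add :: "wave_fun \<Rightarrow> wave_fun \<Rightarrow> wave_fun"  (infixl "\<oplus>" 65) where
  "A \<oplus> B = (\<lambda>\<rho>. case (A \<rho>, B \<rho>) of (Some a, Some b) \<Rightarrow> Some (a + b) | _ \<Rightarrow> None)"

text \<open>
  The inverse is the multiplicative one.  Additive inverses need no operator of their own:
  \<open>wave 0 (1/2)\<close> is the constant -1.
\<close>

definition wave_inverse :: "wave_fun \<Rightarrow> wave_fun" where
  "wave_inverse A =
    (\<lambda>\<rho>. case A \<rho> of Some a \<Rightarrow> (if a = 0 then None else Some (inverse a)) | None \<Rightarrow> None)"

inductive_set real_wave_numbers :: "wave_fun set" where
  wave: "wave f \<theta> \<in> real_wave_numbers"
| mult: "A \<in> real_wave_numbers \<Longrightarrow> B \<in> real_wave_numbers \<Longrightarrow> A \<otimes> B \<in> real_wave_numbers"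
| add: "A \<in> real_wave_numbers \<Longrightarrow> B \<in> real_wave_numbers \<Longrightarrow> A \<oplus> B \<in> real_wave_numbers"
| inverse: "A \<in> real_wave_numbers \<Longrightarrow> wave_inverse A \<in> real_wave_numbers"

text \<open>
  Spin \<open>f\<close> and rotation \<open>\<theta>\<close> belong to a representation \<open>A \<otimes> wave f \<theta>\<close> with
  \<open>A \<in> real_wave_numbers\<close>; they are not functions of the represented element, since
  one element has many such representations.
\<close>

end

theory Submission
  imports Defs
begin

text \<open>
  Exponential terms add their spins and rotations when multiplied, and pointwise
  multiplication is associative and commutative even for partial functions, since both
  bracketings are defined exactly where all factors are.  This gives the product formula
  (\<open>wave_mult_wave\<close>, \<open>wave_mult_assoc\<close>, \<open>wave_mult_commute\<close>).

  For sums the decisive fact is that \<open>wave f \<theta>\<close> is a unit with inverse \<open>wave (- f) (- \<theta>)\<close>,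
  defined on all of the reals.  Hence \<open>wave f \<theta>\<close> can be split off from any real wave number,
  for every choice of \<open>f\<close> and \<open>\<theta>\<close>, without changing its domain (\<open>split_off_wave\<close>).  A sum of
  two real wave numbers is again one, so in particular the spin and rotation
  \<open>(f\<^sub>1 + f\<^sub>2, \<theta>\<^sub>1 + \<theta>\<^sub>2)\<close> can be split off from it.
\<close>

lemma wave_mult_assoc: "(A \<otimes> B) \<otimes> C = A \<otimes> (B \<otimes> C)"
  by (auto simp: wave_mult_def fun_eq_iff mult.assoc split: option.splits)

lemma wave_mult_commute: "A \<otimes> B = B \<otimes> A"
  by (auto simp: wave_mult_def fun_eq_iff mult.commute split: option.splits)

lemma wave_mult_left_commute: "A \<otimes> (B \<otimes> C) = B \<otimes> (A \<otimes> C)"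
  by (metis wave_mult_assoc wave_mult_commute)

lemma wave_mult_wave: "wave f \<theta> \<otimes> wave g \<phi> = wave (f + g) (\<theta> + \<phi>)"
  by (auto simp: wave_mult_def wave_def fun_eq_iff algebra_simps simp flip: exp_add)

lemma wave_mult_wave_0_0: "A \<otimes> wave 0 0 = A"
  by (auto simp: wave_mult_def wave_def fun_eq_iff split: option.splits)

text \<open>
  Exponential terms vanish nowhere and their inverses are again exponential terms, so
  dividing by \<open>wave f \<theta>\<close> stays inside the real wave numbers and loses no point of the domain.
\<close>

lemma split_off_wave:
  assumes "A \<in> real_wave_numbers"
  shows "\<exists>B \<in> real_wave_numbers. A = B \<otimes> wave f \<theta>"
proof
  show "A \<otimes> wave (- f) (- \<theta>) \<in> real_wave_numbers"
    by (intro real_wave_numbers.intros assms)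
  show "A = A \<otimes> wave (- f) (- \<theta>) \<otimes> wave f \<theta>"
    by (simp add: wave_mult_assoc wave_mult_wave wave_mult_wave_0_0)
qed

theorem proposition4p2:
  fixes A\<^sub>1 A\<^sub>2 :: wave_fun and f\<^sub>1 f\<^sub>2 \<theta>\<^sub>1 \<theta>\<^sub>2 :: real
  assumes "A\<^sub>1 \<in> real_wave_numbers" and "A\<^sub>2 \<in> real_wave_numbers"
  shows "A\<^sub>1 \<otimes> A\<^sub>2 \<in> real_wave_numbers \<and>
    (A\<^sub>1 \<otimes> wave f\<^sub>1 \<theta>\<^sub>1) \<otimes> (A\<^sub>2 \<otimes> wave f\<^sub>2 \<theta>\<^sub>2) =
      (A\<^sub>1 \<otimes> A\<^sub>2) \<otimes> wave (f\<^sub>1 + f\<^sub>2) (\<theta>\<^sub>1 + \<theta>\<^sub>2) \<and>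
    (\<exists>A\<^sub>1\<^sub>2 \<in> real_wave_numbers.
      (A\<^sub>1 \<otimes> wave f\<^sub>1 \<theta>\<^sub>1) \<oplus> (A\<^sub>2 \<otimes> wave f\<^sub>2 \<theta>\<^sub>2) =
        A\<^sub>1\<^sub>2 \<otimes> wave (f\<^sub>1 + f\<^sub>2) (\<theta>\<^sub>1 + \<theta>\<^sub>2))"
proof (intro conjI)
  show "A\<^sub>1 \<otimes> A\<^sub>2 \<in> real_wave_numbers"
    using assms by (rule real_wave_numbers.mult)
  show "(A\<^sub>1 \<otimes> wave f\<^sub>1 \<theta>\<^sub>1) \<otimes> (A\<^sub>2 \<otimes> wave f\<^sub>2 \<theta>\<^sub>2) =
      (A\<^sub>1 \<otimes> A\<^sub>2) \<otimes> wave (f\<^sub>1 + f\<^sub>2) (\<theta>\<^sub>1 + \<theta>\<^sub>2)"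
    by (simp add: wave_mult_assoc wave_mult_left_commute[of "wave f\<^sub>1 \<theta>\<^sub>1"] wave_mult_wave)
  show "\<exists>A\<^sub>1\<^sub>2 \<in> real_wave_numbers.
      (A\<^sub>1 \<otimes> wave f\<^sub>1 \<theta>\<^sub>1) \<oplus> (A\<^sub>2 \<otimes> wave f\<^sub>2 \<theta>\<^sub>2) =
        A\<^sub>1\<^sub>2 \<otimes> wave (f\<^sub>1 + f\<^sub>2) (\<theta>\<^sub>1 + \<theta>\<^sub>2)"
    by (intro split_off_wave real_wave_numbers.intros assms)
qed

end
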